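(* Let $\mathcal{A}$ be a finite algebra (with finite signature) having at least two elements. If $\mathcal{A}$ is idemprimal, then $\mathrm{PSpec}(\mathcal{A})$ is dense in $[0,1]$.
   Context: All algebras are (nonempty) algebras in the sense of universal algebra, finite and with a finite signature; an algebra is non-trivial if its universe $A$ has at least two elements. A term is an element of the absolutely free algebra over an infinite set of variables; a term with $k$ variables is interpreted in $\mathcal{A}$ as a function $A^k\to A$. An equation $t\approx t'$ is an ordered pair of terms in the signature; its number of variables $k$ is the total number of distinct variables appearing in it. The probability of the equation over $\mathcal{A}$ is $$\Pr(t\approx t'\mid\mathcal{A})=\frac{|\{\vec{x}\in A^k\mid t(\vec{x})=t'(\vec{x})\}|}{|A|^k},$$ and $\mathrm{PSpec}(\mathcal{A})=\{\Pr(t\approx t'\mid\mathcal{A})\mid t\approx t' \text{ an equation in the signature of }\mathcal{A}\}\subseteq[0,1]$. A function $f:A^k\to A$ ($k\ge1$) is idempotent if $f(x,x,\ldots,x)=x$ for all $x\in A$. An algebra is idemprimal if every idempotent function on its universe is (the interpretation of) a term. A set $X\subseteq[0,1]$ is dense in $[0,1]$ if every $\alpha\in[0,1]$ belongs to $X$ or is a limit point of $X$. *)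

theory Defs
  imports "HOL-Analysis.Analysis"
begin

text \<open>An element of \<open>A\<^sup>k\<close> is a list of length \<open>k\<close> over \<open>A\<close>.  A signature consists of a set of
  symbols with arities (arity 0 is allowed); the values of \<open>arity\<close> and \<open>interp\<close> outside the
  signature, and of \<open>interp\<close> on lists of the wrong length or outside the universe, are irrelevant.\<close>

definition tuples :: "'a set \<Rightarrow> nat \<Rightarrow> 'a list set" where
  "tuples A k = {xs. set xs \<subseteq> A \<and> length xs = k}"

record ('f, 'a) ualg =
  universe :: "'a set"
  symbols :: "'f set"
  arity :: "'f \<Rightarrow> nat"
  interp :: "'f \<Rightarrow> 'a list \<Rightarrow> 'a"

definition is_algebra :: "('f, 'a) ualg \<Rightarrow> bool" where
  "is_algebra \<A> \<longleftrightarrow> universe \<A> \<noteq> {} \<and>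
     (\<forall>f\<in>symbols \<A>. \<forall>xs\<in>tuples (universe \<A>) (arity \<A> f). interp \<A> f xs \<in> universe \<A>)"

definition finite_algebra :: "('f, 'a) ualg \<Rightarrow> bool" where
  "finite_algebra \<A> \<longleftrightarrow> is_algebra \<A> \<and> finite (universe \<A>) \<and> finite (symbols \<A>)"

datatype (symbs_trm: 'f, vars_trm: 'v) trm =
    Var 'v
  | App 'f "('f, 'v) trm list"

text \<open>The terms in the signature of an algebra; the set of variables is \<open>nat\<close>.\<close>

inductive_set terms_of :: "('f, 'a) ualg \<Rightarrow> ('f, nat) trm set" for \<A> :: "('f, 'a) ualg" where
  Var: "Var x \<in> terms_of \<A>"
| App: "f \<in> symbols \<A> \<Longrightarrow> length ts = arity \<A> f \<Longrightarrow> (\<forall>t\<in>set ts. t \<in> terms_of \<A>)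
    \<Longrightarrow> App f ts \<in> terms_of \<A>"

primrec eval_trm :: "('f, 'a) ualg \<Rightarrow> ('v \<Rightarrow> 'a) \<Rightarrow> ('f, 'v) trm \<Rightarrow> 'a" where
  "eval_trm \<A> \<sigma> (Var x) = \<sigma> x"
| "eval_trm \<A> \<sigma> (App f ts) = interp \<A> f (map (eval_trm \<A> \<sigma>) ts)"

text \<open>Here \<open>A\<^sup>k\<close> is indexed by the variables occurring in the equation: its elements are the
  (extensional) assignments of values in \<open>A\<close> to exactly these variables.\<close>

definition eq_prob :: "('f, 'a) ualg \<Rightarrow> ('f, nat) trm \<Rightarrow> ('f, nat) trm \<Rightarrow> real" where
  "eq_prob \<A> t t' =
     real (card {\<sigma> \<in> (vars_trm t \<union> vars_trm t') \<rightarrow>\<^sub>E universe \<A>.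
                   eval_trm \<A> \<sigma> t = eval_trm \<A> \<sigma> t'})
     / real (card (universe \<A>)) ^ card (vars_trm t \<union> vars_trm t')"

definition PSpec :: "('f, 'a) ualg \<Rightarrow> real set" where
  "PSpec \<A> = {eq_prob \<A> t t' | t t'. t \<in> terms_of \<A> \<and> t' \<in> terms_of \<A>}"

definition idempotent_fun :: "'a set \<Rightarrow> nat \<Rightarrow> ('a list \<Rightarrow> 'a) \<Rightarrow> bool" where
  "idempotent_fun A k f \<longleftrightarrow>
     (\<forall>xs\<in>tuples A k. f xs \<in> A) \<and> (\<forall>x\<in>A. f (replicate k x) = x)"

text \<open>The list \<open>xs\<close> assigns its \<open>i\<close>-th entry to the variable \<open>i\<close>, for \<open>i < k\<close>.  As usual, not all of
  these \<open>k\<close> variables have to occur in the term.\<close>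

definition is_term_fun :: "('f, 'a) ualg \<Rightarrow> nat \<Rightarrow> ('a list \<Rightarrow> 'a) \<Rightarrow> bool" where
  "is_term_fun \<A> k f \<longleftrightarrow>
     (\<exists>t\<in>terms_of \<A>. vars_trm t \<subseteq> {..<k} \<and>
        (\<forall>xs\<in>tuples (universe \<A>) k. eval_trm \<A> (\<lambda>i. xs ! i) t = f xs))"

definition idemprimal :: "('f, 'a) ualg \<Rightarrow> bool" where
  "idemprimal \<A> \<longleftrightarrow>
     (\<forall>k\<ge>1. \<forall>f. idempotent_fun (universe \<A>) k f \<longrightarrow> is_term_fun \<A> k f)"

definition dense_in_unit_interval :: "real set \<Rightarrow> bool" where
  "dense_in_unit_interval X \<longleftrightarrow>
     X \<subseteq> {0..1} \<and> (\<forall>\<alpha>\<in>{0..1}. \<alpha> \<in> X \<or> \<alpha> islimpt X)"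

end

theory Submission
  imports Defs
begin

text \<open>
  Write \<open>n\<close> for the size of the universe \<open>A\<close>, and let \<open>S \<subseteq> A\<^sup>k\<close>, where \<open>k \<ge> 1\<close>, be any set of
  tuples that contains the diagonal. A function that agrees with the first projection exactly on \<open>S\<close> is idempotent,
  because the diagonal lies in \<open>S\<close>, and it exists as soon as \<open>n \<ge> 2\<close>, because off \<open>S\<close> a value
  different from the first coordinate is needed. In an idemprimal algebra it is the interpretation
  of a term \<open>t\<close>, and the equation \<open>t \<approx> x\<^sub>0\<close> then has probability \<open>card S / n ^ k\<close>
  (\<open>diagonal_set_prob_in_PSpec\<close>).

  The size of \<open>S\<close> can be any number from \<open>n\<close>, the size of the diagonal, up to \<open>n ^ k\<close>. So the
  spectrum contains every fraction \<open>m / n ^ k\<close> with \<open>n \<le> m \<le> n ^ k\<close>. These form a grid of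
  width \<open>n ^ -k\<close> on the interval from \<open>n / n ^ k\<close> to 1, whose left end tends to 0 as \<open>k\<close> grows;
  hence they are dense.

  The term \<open>t\<close> need not contain all \<open>k\<close> variables, whereas the probability of an equation is
  taken over the variables that do occur. The probability is unchanged when further variables are
  adjoined (\<open>eq_prob_superset\<close>), so it may be computed on \<open>A\<^sup>k\<close> after all
  (\<open>eq_prob_tuples\<close>).
\<close>

section \<open>Terms and their variables\<close>

lemma finite_vars_trm: "finite (vars_trm t)"
  by (induction t) auto

lemma eval_trm_cong:
  assumes "\<And>x. x \<in> vars_trm t \<Longrightarrow> \<sigma> x = \<tau> x"
  shows "eval_trm \<A> \<sigma> t = eval_trm \<A> \<tau> t"
  using assms
proof (induction t)
  case (App f ts)
  have "map (eval_trm \<A> \<sigma>) ts = map (eval_trm \<A> \<tau>) ts"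
    using App by (intro map_cong) auto
  then show ?case by (simp only: eval_trm.simps)
qed simp

section \<open>The probability of an equation\<close>

text \<open>An assignment on \<open>W\<close> amounts to an assignment on \<open>V\<close> together with an independent one on
  \<open>W - V\<close>, and a condition that looks at \<open>V\<close> only restricts the first component.\<close>

lemma card_PiE_superset:
  fixes P :: "('v \<Rightarrow> 'a) \<Rightarrow> bool"
  assumes "finite W" "V \<subseteq> W"
    and P: "\<And>\<sigma> \<tau>. (\<And>x. x \<in> V \<Longrightarrow> \<sigma> x = \<tau> x) \<Longrightarrow> P \<sigma> = P \<tau>"
  shows "card {\<sigma> \<in> W \<rightarrow>\<^sub>E A. P \<sigma>} = card {\<sigma> \<in> V \<rightarrow>\<^sub>E A. P \<sigma>} * card A ^ card (W - V)"
proof -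
  let ?split = "\<lambda>\<sigma>. (restrict \<sigma> V, restrict \<sigma> (W - V))"
  let ?join = "\<lambda>(\<sigma>, \<tau>). (\<lambda>x. if x \<in> V then \<sigma> x else \<tau> x)"
  have P_restrict: "P (restrict \<sigma> V) = P \<sigma>" for \<sigma>
    by (rule P) simp
  have P_join: "P (\<lambda>x. if x \<in> V then \<sigma> x else \<tau> x) = P \<sigma>" for \<sigma> \<tau>
    by (rule P) simp
  have join_left: "restrict (\<lambda>x. if x \<in> V then \<sigma> x else \<tau> x) V = \<sigma>"
    if "\<sigma> \<in> V \<rightarrow>\<^sub>E A" for \<sigma> \<tau>
    by (rule extensionalityI[where A = V]) (use that in \<open>auto simp: PiE_iff\<close>)
  have join_right: "restrict (\<lambda>x. if x \<in> V then \<sigma> x else \<tau> x) (W - V) = \<tau>"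
    if "\<tau> \<in> (W - V) \<rightarrow>\<^sub>E A" for \<sigma> \<tau>
    by (rule extensionalityI[where A = "W - V"]) (use that in \<open>auto simp: PiE_iff\<close>)
  have "bij_betw ?split {\<sigma> \<in> W \<rightarrow>\<^sub>E A. P \<sigma>} ({\<sigma> \<in> V \<rightarrow>\<^sub>E A. P \<sigma>} \<times> ((W - V) \<rightarrow>\<^sub>E A))"
  proof (rule bij_betw_byWitness[where f' = ?join])
    show "\<forall>\<sigma>\<in>{\<sigma> \<in> W \<rightarrow>\<^sub>E A. P \<sigma>}. ?join (?split \<sigma>) = \<sigma>"
      using assms(2) by (auto intro!: extensionalityI[where A = W] simp: PiE_iff extensional_def)
    show "\<forall>p\<in>{\<sigma> \<in> V \<rightarrow>\<^sub>E A. P \<sigma>} \<times> ((W - V) \<rightarrow>\<^sub>E A). ?split (?join p) = p"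
      using join_left join_right by auto
    show "?split ` {\<sigma> \<in> W \<rightarrow>\<^sub>E A. P \<sigma>} \<subseteq> {\<sigma> \<in> V \<rightarrow>\<^sub>E A. P \<sigma>} \<times> ((W - V) \<rightarrow>\<^sub>E A)"
      using assms(2) by (auto simp: P_restrict)
    show "?join ` ({\<sigma> \<in> V \<rightarrow>\<^sub>E A. P \<sigma>} \<times> ((W - V) \<rightarrow>\<^sub>E A)) \<subseteq> {\<sigma> \<in> W \<rightarrow>\<^sub>E A. P \<sigma>}"
      using assms(2) by (auto simp: P_join PiE_iff extensional_def)
  qed
  then have "card {\<sigma> \<in> W \<rightarrow>\<^sub>E A. P \<sigma>} = card ({\<sigma> \<in> V \<rightarrow>\<^sub>E A. P \<sigma>} \<times> ((W - V) \<rightarrow>\<^sub>E A))"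
    by (rule bij_betw_same_card)
  then show ?thesis
    using assms(1) by (simp add: card_cartesian_product card_PiE)
qed

lemma eq_prob_superset:
  assumes "finite W" "vars_trm t \<union> vars_trm t' \<subseteq> W"
    and "finite (universe \<A>)" "universe \<A> \<noteq> {}"
  shows "eq_prob \<A> t t' =
     real (card {\<sigma> \<in> W \<rightarrow>\<^sub>E universe \<A>. eval_trm \<A> \<sigma> t = eval_trm \<A> \<sigma> t'})
     / real (card (universe \<A>)) ^ card W"
proof -
  let ?V = "vars_trm t \<union> vars_trm t'"
  let ?P = "\<lambda>\<sigma>. eval_trm \<A> \<sigma> t = eval_trm \<A> \<sigma> t'"
  have "?P \<sigma> = ?P \<tau>" if "\<And>x. x \<in> ?V \<Longrightarrow> \<sigma> x = \<tau> x" for \<sigma> \<tau>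
    using that eval_trm_cong[of t \<sigma> \<tau> \<A>] eval_trm_cong[of t' \<sigma> \<tau> \<A>] by simp
  then have *: "card {\<sigma> \<in> W \<rightarrow>\<^sub>E universe \<A>. ?P \<sigma>} =
      card {\<sigma> \<in> ?V \<rightarrow>\<^sub>E universe \<A>. ?P \<sigma>} * card (universe \<A>) ^ card (W - ?V)"
    by (rule card_PiE_superset[OF assms(1,2)])
  have "card W = card ?V + card (W - ?V)"
    using assms(1,2) by (metis card_Diff_subset card_mono finite_subset le_add_diff_inverse)
  moreover have "card (universe \<A>) \<noteq> 0"
    using assms(3,4) by simp
  ultimately show ?thesis
    unfolding eq_prob_def * by (simp add: power_add)
qed

lemma bij_betw_PiE_tuples:
  "bij_betw (\<lambda>\<sigma>. map \<sigma> [0..<k]) ({..<k} \<rightarrow>\<^sub>E A) (tuples A k)"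
proof (rule bij_betw_byWitness[where f' = "\<lambda>xs. restrict (\<lambda>i. xs ! i) {..<k}"])
  show "\<forall>\<sigma>\<in>{..<k} \<rightarrow>\<^sub>E A. restrict (\<lambda>i. map \<sigma> [0..<k] ! i) {..<k} = \<sigma>"
    by (intro ballI extensionalityI[where A = "{..<k}"]) (auto simp: PiE_iff)
  show "\<forall>xs\<in>tuples A k. map (restrict (\<lambda>i. xs ! i) {..<k}) [0..<k] = xs"
    by (intro ballI nth_equalityI) (auto simp: tuples_def)
  show "(\<lambda>\<sigma>. map \<sigma> [0..<k]) ` ({..<k} \<rightarrow>\<^sub>E A) \<subseteq> tuples A k"
    by (rule image_subsetI) (simp add: tuples_def PiE_iff image_subset_iff)
  show "(\<lambda>xs. restrict (\<lambda>i. xs ! i) {..<k}) ` tuples A k \<subseteq> {..<k} \<rightarrow>\<^sub>E A"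
    by (rule image_subsetI) (auto simp only: tuples_def restrict_PiE_iff mem_Collect_eq
        lessThan_iff intro: subsetD[OF _ nth_mem])
qed

lemma eq_prob_tuples:
  assumes "vars_trm t \<union> vars_trm t' \<subseteq> {..<k}"
    and "finite (universe \<A>)" "universe \<A> \<noteq> {}"
  shows "eq_prob \<A> t t' =
     real (card {xs \<in> tuples (universe \<A>) k.
                   eval_trm \<A> (\<lambda>i. xs ! i) t = eval_trm \<A> (\<lambda>i. xs ! i) t'})
     / real (card (universe \<A>)) ^ k"
proof -
  let ?A = "universe \<A>"
  let ?list = "\<lambda>\<sigma>. map \<sigma> [0..<k]"
  have eval: "eval_trm \<A> (\<lambda>i. ?list \<sigma> ! i) s = eval_trm \<A> \<sigma> s"
    if "vars_trm s \<subseteq> {..<k}" for \<sigma> s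
    using that by (intro eval_trm_cong) auto
  have "bij_betw ?list {\<sigma> \<in> {..<k} \<rightarrow>\<^sub>E ?A. eval_trm \<A> \<sigma> t = eval_trm \<A> \<sigma> t'}
      {xs \<in> tuples ?A k. eval_trm \<A> (\<lambda>i. xs ! i) t = eval_trm \<A> (\<lambda>i. xs ! i) t'}"
    using assms(1) by (intro bij_betw_Collect[OF bij_betw_PiE_tuples]) (simp add: eval)
  from bij_betw_same_card[OF this] show ?thesis
    using eq_prob_superset[of "{..<k}" t t' \<A>] assms by simp
qed

lemma eq_prob_in_unit_interval:
  assumes "finite (universe \<A>)"
  shows "eq_prob \<A> t t' \<in> {0..1}"
proof -
  let ?V = "vars_trm t \<union> vars_trm t'"
  let ?S = "{\<sigma> \<in> ?V \<rightarrow>\<^sub>E universe \<A>. eval_trm \<A> \<sigma> t = eval_trm \<A> \<sigma> t'}"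
  have "finite ?V"
    by (simp add: finite_vars_trm)
  then have "finite (?V \<rightarrow>\<^sub>E universe \<A>)" "card (?V \<rightarrow>\<^sub>E universe \<A>) = card (universe \<A>) ^ card ?V"
    using assms by (auto simp: finite_PiE card_PiE)
  then have "card ?S \<le> card (universe \<A>) ^ card ?V"
    by (metis (no_types, lifting) card_mono mem_Collect_eq subsetI)
  then have "real (card ?S) \<le> real (card (universe \<A>)) ^ card ?V"
    by (simp flip: of_nat_power)
  then have "eq_prob \<A> t t' \<le>
      real (card (universe \<A>)) ^ card ?V / real (card (universe \<A>)) ^ card ?V"
    unfolding eq_prob_def by (intro divide_right_mono) simp_all
  also have "\<dots> \<le> 1"
    by (simp add: divide_self_if)
  finally show ?thesis
    by (simp add: eq_prob_def)
qed

section \<open>Probabilities realised in an idemprimal algebra\<close>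

lemma card_tuples: "finite A \<Longrightarrow> card (tuples A k) = card A ^ k"
  unfolding tuples_def by (rule card_lists_length_eq)

lemma finite_tuples: "finite A \<Longrightarrow> finite (tuples A k)"
  unfolding tuples_def by (rule finite_lists_length_eq)

lemma diagonal_set_prob_in_PSpec:
  assumes "finite (universe \<A>)" "card (universe \<A>) \<ge> 2" "idemprimal \<A>" "k \<ge> 1"
    and S: "S \<subseteq> tuples (universe \<A>) k" "\<And>x. x \<in> universe \<A> \<Longrightarrow> replicate k x \<in> S"
  shows "real (card S) / real (card (universe \<A>)) ^ k \<in> PSpec \<A>"
proof -
  let ?A = "universe \<A>"
  have "\<exists>y\<in>?A. y \<noteq> x" for x
  proof (rule ccontr)
    assume "\<not> (\<exists>y\<in>?A. y \<noteq> x)"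
    then have "?A \<subseteq> {x}" by blast
    then have "card ?A \<le> card {x}" by (intro card_mono) auto
    with assms(2) show False by simp
  qed
  then obtain other where other: "\<And>x. other x \<in> ?A" "\<And>x. other x \<noteq> x"
    by metis
  define f where "f xs = (if xs \<in> S then xs ! 0 else other (xs ! 0))" for xs
  have "xs ! 0 \<in> ?A" if "xs \<in> tuples ?A k" for xs
    using that assms(4) subsetD[OF _ nth_mem, of xs _ 0] by (simp add: tuples_def)
  then have "idempotent_fun ?A k f"
    using assms(4) S(2) other(1) by (simp add: idempotent_fun_def f_def)
  then obtain t where t: "t \<in> terms_of \<A>" "vars_trm t \<subseteq> {..<k}"
      "\<And>xs. xs \<in> tuples ?A k \<Longrightarrow> eval_trm \<A> (\<lambda>i. xs ! i) t = f xs"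
    using assms(3,4) unfolding idemprimal_def is_term_fun_def by blast
  have "{xs \<in> tuples ?A k. eval_trm \<A> (\<lambda>i. xs ! i) t = eval_trm \<A> (\<lambda>i. xs ! i) (Var 0)} = S"
    using S(1) other(2) by (auto simp: t(3) f_def split: if_splits)
  moreover have "vars_trm t \<union> vars_trm (Var 0) \<subseteq> {..<k}" "?A \<noteq> {}"
    using t(2) assms(2,4) by auto
  ultimately have "eq_prob \<A> t (Var 0) = real (card S) / real (card ?A) ^ k"
    using eq_prob_tuples[of t "Var 0" k \<A>] assms(1) by simp
  then show ?thesis
    unfolding PSpec_def using t(1) terms_of.Var[of 0 \<A>]
    by (metis (mono_tags, lifting) mem_Collect_eq)
qed

lemma fraction_in_PSpec:
  assumes "finite (universe \<A>)" "card (universe \<A>) \<ge> 2" "idemprimal \<A>" "k \<ge> 1"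
    and m: "card (universe \<A>) \<le> m" "m \<le> card (universe \<A>) ^ k"
  shows "real m / real (card (universe \<A>)) ^ k \<in> PSpec \<A>"
proof -
  let ?A = "universe \<A>"
  let ?D = "replicate k ` ?A"
  have D: "?D \<subseteq> tuples ?A k" "card ?D \<le> m"
    using m(1) card_image_le[OF assms(1), of "replicate k"] by (auto simp: tuples_def)
  obtain S where "?D \<subseteq> S" "S \<subseteq> tuples ?A k" "card S = m"
    using exists_subset_between[OF D(2) _ D(1)] m(2) assms(1)
    by (auto simp: card_tuples finite_tuples)
  then show ?thesis
    using diagonal_set_prob_in_PSpec[OF assms(1-4), of S] by auto
qed

section \<open>Density\<close>

text \<open>The truncated grid still comes within \<open>n / n ^ k\<close> of every \<open>\<alpha>\<close>: either rounding \<open>\<alpha> * n ^ k\<close>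
  down gives an admissible numerator, or \<open>\<alpha> < n / n ^ k\<close> and the numerator \<open>n\<close> will do.\<close>

lemma unit_interval_approx_power_fraction:
  fixes \<alpha> e :: real and n :: nat
  assumes "n \<ge> 2" "\<alpha> \<in> {0..1}" "e > 0"
  shows "\<exists>k\<ge>1. \<exists>m. n \<le> m \<and> m \<le> n ^ k \<and> \<bar>real m / real n ^ k - \<alpha>\<bar> < e"
proof -
  obtain j where j: "(1 / real n) ^ j < e"
    using real_arch_pow_inv[of e "1 / real n"] assms by auto
  define N where "N = n ^ Suc j"
  have N: "real N > 0" "n \<le> N" "real n / real N < e"
    using j assms(1) by (auto simp: N_def power_one_over field_simps)
  define m where "m = max n (nat \<lfloor>\<alpha> * real N\<rfloor>)"
  have \<alpha>: "0 \<le> \<alpha> * real N" "\<alpha> * real N \<le> real N"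
    using assms(2) N(1) by (auto simp: mult_le_cancel_right1)
  have floor: "real (nat \<lfloor>\<alpha> * real N\<rfloor>) \<le> \<alpha> * real N"
       "\<alpha> * real N < real (nat \<lfloor>\<alpha> * real N\<rfloor>) + 1"
    using \<alpha>(1) by linarith+
  then have "nat \<lfloor>\<alpha> * real N\<rfloor> \<le> N"
    using \<alpha>(2) by (metis of_nat_le_iff order_trans)
  then have "m \<le> N"
    using N(2) by (simp add: m_def)
  have "\<bar>real m - \<alpha> * real N\<bar> \<le> real n"
  proof (cases "n \<le> nat \<lfloor>\<alpha> * real N\<rfloor>")
    case True
    then have "real m = real (nat \<lfloor>\<alpha> * real N\<rfloor>)" "real n \<ge> 2"
      using assms(1) by (auto simp: m_def)
    with floor show ?thesis by linarith
  next
    case False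
    then have "real m = real n" "real (nat \<lfloor>\<alpha> * real N\<rfloor>) + 1 \<le> real n"
      by (auto simp: m_def)
    with floor \<alpha>(1) show ?thesis by linarith
  qed
  have "\<bar>real m / real N - \<alpha>\<bar> = \<bar>real m - \<alpha> * real N\<bar> / real N"
    using N(1) by (simp add: field_simps)
  also have "\<dots> \<le> real n / real N"
    using \<open>\<bar>real m - \<alpha> * real N\<bar> \<le> real n\<close> N(1) by (simp add: divide_right_mono)
  also have "\<dots> < e"
    by (rule N(3))
  finally have "\<bar>real m / real n ^ Suc j - \<alpha>\<bar> < e"
    by (simp add: N_def)
  with \<open>m \<le> N\<close> show ?thesis
    by (intro exI[of _ "Suc j"] conjI exI[of _ m]) (auto simp: m_def N_def)
qed

theorem theorem4p4:
  fixes \<A> :: "('f, 'a) ualg"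
  assumes "finite_algebra \<A>"
    and "card (universe \<A>) \<ge> 2"
    and "idemprimal \<A>"
  shows "dense_in_unit_interval (PSpec \<A>)"
proof -
  have fin: "finite (universe \<A>)"
    using assms(1) by (simp add: finite_algebra_def)
  have "PSpec \<A> \<subseteq> {0..1}"
    using eq_prob_in_unit_interval[OF fin] by (auto simp: PSpec_def)
  moreover have "\<alpha> \<in> closure (PSpec \<A>)" if "\<alpha> \<in> {0..1}" for \<alpha>
    unfolding closure_approachable
  proof (intro allI impI)
    fix e :: real
    assume "e > 0"
    then obtain k m where "k \<ge> 1" "card (universe \<A>) \<le> m" "m \<le> card (universe \<A>) ^ k"
        "\<bar>real m / real (card (universe \<A>)) ^ k - \<alpha>\<bar> < e"
      using unit_interval_approx_power_fraction[OF assms(2) \<open>\<alpha> \<in> {0..1}\<close>] by blast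
    then show "\<exists>y\<in>PSpec \<A>. dist y \<alpha> < e"
      using fraction_in_PSpec[OF fin assms(2,3)] by (auto simp: dist_real_def)
  qed
  ultimately show ?thesis
    by (auto simp: dense_in_unit_interval_def closure_def)
qed

end
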